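(* Let $x>0$ and $h\ge1$ be real numbers and let $k\ge1$ be an integer. The following statements are equivalent. (i) $A_k(x,h)\ge 0$ (positive semi-definite); (ii) $\det A_k(x,h)\ge0$; (iii) $f_k\equiv f(x,h,k)\ge 0$; (iv) $x\ge b(k,h)$.
   Context: For real $x,h>0$ and an integer $k\ge1$, $A_k(x,h)$ is the $(k+1)\times(k+1)$ matrix with $(1,1)$ entry equal to $x$ and $(i,j)$ entry equal to $\frac{1}{(i+j-2)h+1}$ for all $(i,j)\ne(1,1)$, $1\le i,j\le k+1$. For fixed $x,h,k$, define $f_0:=x$ and $$f_{\ell+1}:=f_\ell\left(\frac{(k-\ell)h+1}{(k-\ell)h}\right)^2-\frac{2(k-\ell)h+1}{((k-\ell)h)^2}\qquad(0\le \ell\le k-1),$$ and write $f(x,h,k)$ for the final term $f_k$. Define recursively $$b(1,h):=\frac{2h+1}{(h+1)^2},\qquad b(j,h):=\left[b(j-1,h)+\frac{2jh+1}{(jh)^2}\right]\left(\frac{jh}{jh+1}\right)^2\quad(2\le j\le k).$$ *)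

theory Defs
  imports Complex_Main "Jordan_Normal_Form.Determinant"
begin

(* Matrices are indexed from 0, so the entry in position (i+1, j+1) of the usual 1-based
   numbering is 1 / ((i + j) h + 1), except that the top left corner is x. *)
definition A_mat :: "nat \<Rightarrow> real \<Rightarrow> real \<Rightarrow> real mat" where
  "A_mat k x h = mat (k + 1) (k + 1)
     (\<lambda>(i, j). if i = 0 \<and> j = 0 then x else 1 / (real (i + j) * h + 1))"

definition pos_semidef :: "real mat \<Rightarrow> bool" where
  "pos_semidef A \<longleftrightarrow>
     square_mat A \<and> transpose_mat A = A \<and>
     (\<forall>v \<in> carrier_vec (dim_row A). v \<bullet> (A *\<^sub>v v) \<ge> 0)"

(* Only the terms with index at most k are meaningful: the step from l to l + 1
   divides by (k - l) h, so it is used for l < k only. *)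
primrec f_seq :: "real \<Rightarrow> real \<Rightarrow> nat \<Rightarrow> nat \<Rightarrow> real" where
  "f_seq x h k 0 = x"
| "f_seq x h k (Suc l) =
     f_seq x h k l * (((real k - real l) * h + 1) / ((real k - real l) * h))\<^sup>2
     - (2 * (real k - real l) * h + 1) / ((real k - real l) * h)\<^sup>2"

definition f_final :: "real \<Rightarrow> real \<Rightarrow> nat \<Rightarrow> real" where
  "f_final x h k = f_seq x h k k"

(* The sequence starts at index 1; the value at 0 is a dummy and is never used. *)
fun b_seq :: "nat \<Rightarrow> real \<Rightarrow> real" where
  "b_seq 0 h = 0"
| "b_seq (Suc 0) h = (2 * h + 1) / (h + 1)\<^sup>2"
| "b_seq (Suc (Suc n)) h =
     (let j = real (n + 2)
      in (b_seq (Suc n) h + (2 * j * h + 1) / (j * h)\<^sup>2) * (j * h / (j * h + 1))\<^sup>2)"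

end

theory Submission
  imports Defs
begin

text \<open>
  With \<open>m\<^sub>i\<^sub>j = 1 / ((i + j) h + 1)\<close> and \<open>c = k h\<close>, eliminating the last row and column
  of a Cauchy-type matrix reproduces it up to a diagonal scaling:
  \<open>m\<^sub>i\<^sub>j - m\<^sub>i\<^sub>k m\<^sub>k\<^sub>j / m\<^sub>k\<^sub>k = d\<^sub>i d\<^sub>j m\<^sub>i\<^sub>j\<close> with \<open>d\<^sub>i = (c - i h) / (c + i h + 1)\<close>.
  Hence \<open>A\<^sub>k(x, h)\<close> is congruent to the direct sum of \<open>A\<^sub>k\<^sub>-\<^sub>1(f\<^sub>1, h)\<close> and a positive scalar:
  the corner \<open>x\<close> becomes \<open>(x - (2c + 1) / (c + 1)\<^sup>2) / d\<^sub>0\<^sup>2 = f\<^sub>1\<close>. Congruence preserves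
  semidefiniteness and the sign of the determinant, so after \<open>k\<close> eliminations both are decided
  by the \<open>1 \<times> 1\<close> matrix with entry \<open>f\<^sub>k\<close>. Finally, with \<open>P = \<Prod>\<^sub>j (j h / (j h + 1))\<^sup>2\<close>, the two
  recursions telescope to \<open>(1 - f\<^sub>k) P = 1 - x\<close> and \<open>1 - b(k, h) = P\<close>.
\<close>

section \<open>Semidefiniteness under congruence and block sums\<close>

text \<open>The quadratic form of \<open>L * A * transpose_mat L\<close> at \<open>v\<close> is that
  of \<open>A\<close> at \<open>transpose_mat L *\<^sub>v v\<close>.\<close>

lemma pos_semidef_congruence:
  assumes A: "A \<in> carrier_mat n n" and L: "L \<in> carrier_mat n n" and psd: "pos_semidef A"
  shows "pos_semidef (L * A * transpose_mat L)"
  unfolding pos_semidef_def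
proof (intro conjI ballI)
  show "square_mat (L * A * transpose_mat L)" using A L by simp
  have "transpose_mat A = A" using psd by (simp add: pos_semidef_def)
  then show "transpose_mat (L * A * transpose_mat L) = L * A * transpose_mat L"
    using A L by (simp add: transpose_mult[of _ n n _ n] assoc_mult_mat[of _ n n _ n _ n])
next
  fix v :: "real vec" assume "v \<in> carrier_vec (dim_row (L * A * transpose_mat L))"
  then have v: "v \<in> carrier_vec n" using L by simp
  define w where "w = transpose_mat L *\<^sub>v v"
  have w: "w \<in> carrier_vec n" using L v by (simp add: w_def)
  have "L * A * transpose_mat L *\<^sub>v v = L *\<^sub>v (A *\<^sub>v w)"
    using A L v by (simp add: w_def assoc_mult_mat_vec[of _ n n _ n])
  then have "v \<bullet> (L * A * transpose_mat L *\<^sub>v v) = w \<bullet> (A *\<^sub>v w)"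
    using transpose_vec_mult_scalar[OF L _ v, of "A *\<^sub>v w"] A w by (simp add: w_def)
  then show "v \<bullet> (L * A * transpose_mat L *\<^sub>v v) \<ge> 0"
    using psd w A by (simp add: pos_semidef_def)
qed

lemma pos_semidef_congruence_iff:
  assumes A: "A \<in> carrier_mat n n" and L: "L \<in> carrier_mat n n" and "det L \<noteq> 0"
  shows "pos_semidef (L * A * transpose_mat L) \<longleftrightarrow> pos_semidef A"
proof
  \<comment> \<open>For the converse, congruence by the inverse \<open>M\<close> of \<open>L\<close>
    leads back to \<open>A\<close>.\<close>
  from det_non_zero_imp_unit[OF L \<open>det L \<noteq> 0\<close>]
  obtain M where M: "M \<in> carrier_mat n n" and inv_L: "M * L = 1\<^sub>m n"
    by (auto simp: Units_def ring_mat_def)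
  have inv_L_transp: "transpose_mat L * transpose_mat M = 1\<^sub>m n"
    using transpose_mult[OF M L] inv_L by simp
  have "M * (L * A * transpose_mat L) * transpose_mat M
      = (M * L) * A * (transpose_mat L * transpose_mat M)"
    using A L M by (simp add: assoc_mult_mat[of _ n n _ n _ n])
  also have "\<dots> = A" using A by (simp add: inv_L inv_L_transp)
  finally have undo: "M * (L * A * transpose_mat L) * transpose_mat M = A" .
  assume "pos_semidef (L * A * transpose_mat L)"
  with undo show "pos_semidef A"
    using pos_semidef_congruence[of "L * A * transpose_mat L" n M] A L M by simp
qed (use pos_semidef_congruence A L in blast)

text \<open>The quadratic form splits into the sum of those of the blocks, and padding a vector with
  zeros isolates either summand. Symmetry, being part of \<open>pos_semidef\<close>, is compared
  block by block.\<close>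

lemma pos_semidef_block_diag:
  assumes A: "A \<in> carrier_mat n n" and D: "D \<in> carrier_mat m m"
  shows "pos_semidef (four_block_mat A (0\<^sub>m n m) (0\<^sub>m m n) D)
    \<longleftrightarrow> pos_semidef A \<and> pos_semidef D" (is "pos_semidef ?B \<longleftrightarrow> _")
proof -
  have quad: "(a @\<^sub>v d) \<bullet> (?B *\<^sub>v (a @\<^sub>v d)) = a \<bullet> (A *\<^sub>v a) + d \<bullet> (D *\<^sub>v d)"
    if "a \<in> carrier_vec n" "d \<in> carrier_vec m" for a d
    using that A D by (simp add: mult_mat_vec_split scalar_prod_append[of _ n _ m])
  have transp: "transpose_mat ?B = ?B \<longleftrightarrow> transpose_mat A = A \<and> transpose_mat D = D"
  proof -
    have tr: "transpose_mat ?B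
        = four_block_mat (transpose_mat A) (0\<^sub>m n m) (0\<^sub>m m n) (transpose_mat D)"
      using A D by (simp add: transpose_four_block_mat[of A n n _ m _ m])
    show ?thesis
    proof
      assume "transpose_mat ?B = ?B"
      then have eq: "four_block_mat (transpose_mat A) (0\<^sub>m n m) (0\<^sub>m m n) (transpose_mat D) = ?B"
        by (simp add: tr)
      have "transpose_mat A = A"
      proof (rule eq_matI)
        fix i j assume "i < dim_row A" "j < dim_col A"
        then show "transpose_mat A $$ (i, j) = A $$ (i, j)"
          using arg_cong[OF eq, of "\<lambda>M. M $$ (i, j)"] A D by simp
      qed (use A in auto)
      moreover have "transpose_mat D = D"
      proof (rule eq_matI)
        fix i j assume "i < dim_row D" "j < dim_col D"
        then show "transpose_mat D $$ (i, j) = D $$ (i, j)"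
          using arg_cong[OF eq, of "\<lambda>M. M $$ (n + i, n + j)"] A D by simp
      qed (use D in auto)
      ultimately show "transpose_mat A = A \<and> transpose_mat D = D" ..
    qed (simp add: tr)
  qed
  have "(\<forall>v \<in> carrier_vec (n + m). v \<bullet> (?B *\<^sub>v v) \<ge> 0) \<longleftrightarrow>
      (\<forall>a \<in> carrier_vec n. a \<bullet> (A *\<^sub>v a) \<ge> 0) \<and> (\<forall>d \<in> carrier_vec m. d \<bullet> (D *\<^sub>v d) \<ge> 0)"
    (is "?l \<longleftrightarrow> ?r")
  proof
    assume l: ?l
    show ?r
    proof (intro conjI ballI)
      fix a :: "real vec" assume "a \<in> carrier_vec n"
      then show "a \<bullet> (A *\<^sub>v a) \<ge> 0"
        using l[rule_format, of "a @\<^sub>v 0\<^sub>v m"] quad[of a "0\<^sub>v m"] D by simp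
    next
      fix d :: "real vec" assume "d \<in> carrier_vec m"
      then show "d \<bullet> (D *\<^sub>v d) \<ge> 0"
        using l[rule_format, of "0\<^sub>v n @\<^sub>v d"] quad[of "0\<^sub>v n" d] A by simp
    qed
  next
    assume r: ?r
    show ?l
    proof
      fix v :: "real vec" assume v: "v \<in> carrier_vec (n + m)"
      have "v = vec_first v n @\<^sub>v vec_last v m"
        using vec_first_last_append[OF v] by simp
      then show "v \<bullet> (?B *\<^sub>v v) \<ge> 0"
        using quad[of "vec_first v n" "vec_last v m"] r by simp
    qed
  qed
  with transp A D show ?thesis by (auto simp: pos_semidef_def)
qed

section \<open>Eliminating the last row and column\<close>

lemma A_mat_carrier [simp]: "A_mat k x h \<in> carrier_mat (Suc k) (Suc k)"
  by (simp add: A_mat_def)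

text \<open>A step depends on the two indices only through their difference, so after one step the
  recursion for \<open>Suc k\<close> is the recursion for \<open>k\<close> restarted at the new
  corner.\<close>

lemma f_seq_Suc:
  "f_seq x h (Suc k) (Suc l) = f_seq (f_seq x h (Suc k) 1) h k l"
  by (induction l) simp_all

text \<open>With \<open>a = i h\<close> and \<open>b = j h\<close> this is the Schur complement
  identity for the Cauchy-type entries; the second summand is the rank-one term removed by the
  elimination.\<close>

lemma cauchy_schur_complement:
  fixes a b c :: real
  assumes "a \<ge> 0" "b \<ge> 0" "c \<ge> 0"
  shows "(c - a) / (c + a + 1) * ((c - b) / (c + b + 1) * (1 / (a + b + 1)))
      + (2 * c + 1) / ((c + a + 1) * (c + b + 1)) = 1 / (a + b + 1)"
proof -
  have "(c - a) * (c - b) + (2 * c + 1) * (a + b + 1) = (c + a + 1) * (c + b + 1)"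
    by (simp add: algebra_simps)
  moreover have "c + a + 1 \<noteq> 0" "c + b + 1 \<noteq> 0" "a + b + 1 \<noteq> 0" using assms by auto
  ultimately show ?thesis by (simp add: divide_simps)
qed

lemma A_mat_congruence:
  assumes h: "h > 0"
  obtains L g where "L \<in> carrier_mat (Suc (Suc k)) (Suc (Suc k))" "det L \<noteq> 0" "g > 0"
    "A_mat (Suc k) x h = L * four_block_mat (A_mat k (f_seq x h (Suc k) 1) h) (0\<^sub>m (Suc k) 1)
        (0\<^sub>m 1 (Suc k)) (mat 1 1 (\<lambda>_. g)) * transpose_mat L"
proof -
  define n where "n = Suc k"
  define c where "c = real n * h"
  have c: "c > 0" using h by (simp add: c_def n_def)
  define y where "y = f_seq x h (Suc k) 1"
  have y: "y = x * ((c + 1) / c)\<^sup>2 - (2 * c + 1) / c\<^sup>2"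
    by (simp add: y_def c_def n_def mult.assoc)
  define d where "d i = (c - real i * h) / (c + real i * h + 1)" for i :: nat
  define A where "A = A_mat k y h"
  \<comment> \<open>\<open>U\<close> is the last column divided by the pivot
    \<open>1 / (2 * c + 1)\<close>, and \<open>G\<close> is that pivot. \<open>L\<close> undoes the
    elimination, so the larger matrix is the congruence image of a block sum.\<close>
  define U where "U = mat n 1 (\<lambda>(i, j). (2 * c + 1) / (c + real i * h + 1))"
  define G where "G = mat 1 1 (\<lambda>_ :: nat \<times> nat. 1 / (2 * c + 1))"
  define L where "L = four_block_mat (mat_diag n d) U (0\<^sub>m 1 n) (1\<^sub>m 1)"
  have A: "A \<in> carrier_mat n n" and U: "U \<in> carrier_mat n 1" and G: "G \<in> carrier_mat 1 1"
    by (simp_all add: A_def U_def G_def n_def)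
  have L: "L \<in> carrier_mat (Suc n) (Suc n)"
    using four_block_carrier_mat[of "mat_diag n d" n n "1\<^sub>m 1" 1 1] by (simp add: L_def)
  \<comment> \<open>The factor \<open>d i\<close> vanishes exactly at the eliminated index
    \<open>i = n\<close>; below it the scaling is invertible.\<close>
  have "d i \<noteq> 0" if "i < n" for i
  proof -
    have "real i * h < c" using that h by (simp add: c_def)
    moreover have "real i * h \<ge> 0" using h by simp
    ultimately show ?thesis using c by (simp add: d_def)
  qed
  then have "det (mat_diag n d) \<noteq> 0"
    by (subst det_upper_triangular[of _ n]) (auto simp: diag_mat_def mat_diag_def prod_list_zero_iff)
  then have detL: "det L \<noteq> 0"
    using U by (simp add: L_def det_four_block_mat_lower_left_zero[of _ n _ 1])
  have dA: "mat_diag n d * A \<in> carrier_mat n n"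
    using A by (intro mult_carrier_mat[of _ n n]) auto
  have LB: "L * four_block_mat A (0\<^sub>m n 1) (0\<^sub>m 1 n) G
      = four_block_mat (mat_diag n d * A) (U * G) (0\<^sub>m 1 n) G"
    unfolding L_def using A U G dA
    by (subst mult_four_block_mat[of _ n n _ 1 _ 1 _ _ n _ 1])
      (auto simp: carrier_matD[OF mat_diag_dim])
  have LT: "transpose_mat L = four_block_mat (mat_diag n d) (0\<^sub>m n 1) (transpose_mat U) (1\<^sub>m 1)"
    unfolding L_def using U
    by (subst transpose_four_block_mat[of _ n n _ 1 _ 1])
      (auto simp: mat_diag_def intro!: eq_matI)
  have prod: "L * four_block_mat A (0\<^sub>m n 1) (0\<^sub>m 1 n) G * transpose_mat L
      = four_block_mat (mat_diag n d * A * mat_diag n d + U * G * transpose_mat U) (U * G)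
          (G * transpose_mat U) G" (is "_ = ?R")
    unfolding LB LT using A U G dA
    by (subst mult_four_block_mat[of _ n n _ 1 _ 1 _ _ n _ 1])
      (auto simp: carrier_matD[OF mat_diag_dim] left_mult_zero_mat[OF mat_diag_dim])
  have core: "mat_diag n d * A * mat_diag n d = mat n n (\<lambda>(i, j). d i * A $$ (i, j) * d j)"
    using A by (subst mat_diag_mult_left[OF A], subst mat_diag_mult_right[of _ n])
      (auto intro!: eq_matI)
  have G00: "G $$ (0, 0) = 1 / (2 * c + 1)"
    by (simp add: G_def)
  have UG: "U * G = mat n 1 (\<lambda>(i, j). 1 / (c + real i * h + 1))"
    using c by (auto intro!: eq_matI simp: U_def G_def scalar_prod_def)
  have GU: "G * transpose_mat U = mat 1 n (\<lambda>(i, j). 1 / (c + real j * h + 1))"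
    using c by (auto intro!: eq_matI simp: U_def G_def scalar_prod_def)
  have UGU: "U * G * transpose_mat U
      = mat n n (\<lambda>(i, j). (2 * c + 1) / ((c + real i * h + 1) * (c + real j * h + 1)))"
    unfolding UG by (auto intro!: eq_matI simp: U_def scalar_prod_def)
  have entry: "d i * A $$ (i, j) * d j
      + (2 * c + 1) / ((c + real i * h + 1) * (c + real j * h + 1))
      = (if i = 0 \<and> j = 0 then x else 1 / (real (i + j) * h + 1))" if "i < n" "j < n" for i j
  proof (cases "i = 0 \<and> j = 0")
    case True
    \<comment> \<open>Here \<open>d 0 = c / (c + 1)\<close>. The corner is outside the Cauchy
      pattern, and the recursion for \<open>f_seq\<close> is this equation solved for
      \<open>y\<close>.\<close>
    have "(c / (c + 1))\<^sup>2 * y + (2 * c + 1) / (c + 1)\<^sup>2 = x"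
      using c by (simp add: y field_simps)
    then show ?thesis using True
      by (simp add: d_def A_def A_mat_def power2_eq_square mult_ac)
  next
    case False
    then have "A $$ (i, j) = 1 / (real i * h + real j * h + 1)"
      using that by (auto simp: A_def A_mat_def n_def algebra_simps)
    moreover have "(if i = 0 \<and> j = 0 then x else 1 / (real (i + j) * h + 1))
        = 1 / (real i * h + real j * h + 1)"
      using False by (auto simp: algebra_simps)
    ultimately show ?thesis
      using cauchy_schur_complement[of "real i * h" "real j * h" c] h c
      by (simp add: d_def mult_ac)
  qed
  have "A_mat (Suc k) x h = ?R"
  proof (rule eq_matI)
    fix i j assume "i < dim_row ?R" "j < dim_col ?R"
    then have ij: "i < Suc n" "j < Suc n" using A U G by auto
    show "A_mat (Suc k) x h $$ (i, j) = ?R $$ (i, j)"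
    proof (cases "i < n \<and> j < n")
      case True
      then have "?R $$ (i, j) = d i * A $$ (i, j) * d j
          + (2 * c + 1) / ((c + real i * h + 1) * (c + real j * h + 1))"
        using A U G by (simp add: core UGU)
      also have "\<dots> = A_mat (Suc k) x h $$ (i, j)"
        using True by (subst entry) (auto simp: A_mat_def n_def)
      finally show ?thesis ..
    next
      case False
      with ij consider "i < n" "j = n" | "i = n" "j < n" | "i = n" "j = n" by linarith
      then show ?thesis
        by cases (use A U G G00 in \<open>auto simp: core UGU UG GU A_mat_def c_def n_def algebra_simps\<close>)
    qed
  qed (use A U G in \<open>auto simp: A_mat_def n_def\<close>)
  with prod L detL c show thesis
    by (intro that[of L "1 / (2 * c + 1)"]) (simp_all add: A_def G_def n_def y_def)
qed

section \<open>Reduction to a single entry\<close>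

lemma pos_semidef_1x1: "pos_semidef (mat 1 1 (\<lambda>_. a)) \<longleftrightarrow> a \<ge> 0"
proof
  assume "pos_semidef (mat 1 1 (\<lambda>_. a))"
  then have "vec 1 (\<lambda>_. 1) \<bullet> (mat 1 1 (\<lambda>_. a) *\<^sub>v vec 1 (\<lambda>_. 1)) \<ge> 0"
    unfolding pos_semidef_def by auto
  then show "a \<ge> 0" by (simp add: scalar_prod_def)
next
  assume "a \<ge> 0"
  then have "v $ 0 * (a * v $ 0) \<ge> 0" for v :: "real vec"
    by (simp add: mult.left_commute)
  then show "pos_semidef (mat 1 1 (\<lambda>_. a))"
    by (auto simp: pos_semidef_def scalar_prod_def intro!: eq_matI)
qed

lemma A_mat_0: "A_mat 0 x h = mat 1 1 (\<lambda>_. x)"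
  by (rule eq_matI) (auto simp: A_mat_def)

text \<open>Each elimination lowers \<open>k\<close> by one and multiplies the determinant by a
  positive factor. The corner changes as well, so the induction is over all
  \<open>x\<close>.\<close>

lemma A_mat_psd_det_iff:
  assumes h: "h > 0"
  shows "(pos_semidef (A_mat k x h) \<longleftrightarrow> f_final x h k \<ge> 0) \<and>
    (det (A_mat k x h) \<ge> 0 \<longleftrightarrow> f_final x h k \<ge> 0)"
proof (induction k arbitrary: x)
  case 0
  show ?case
    by (simp only: A_mat_0 pos_semidef_1x1) (simp add: det_single f_final_def)
next
  case (Suc k)
  define y where "y = f_seq x h (Suc k) 1"
  have f: "f_final x h (Suc k) = f_final y h k"
    by (simp only: f_final_def y_def f_seq_Suc)
  obtain L g where L: "L \<in> carrier_mat (Suc (Suc k)) (Suc (Suc k))" and detL: "det L \<noteq> 0"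
    and g: "g > 0"
    and eq: "A_mat (Suc k) x h = L * four_block_mat (A_mat k y h) (0\<^sub>m (Suc k) 1)
        (0\<^sub>m 1 (Suc k)) (mat 1 1 (\<lambda>_. g)) * transpose_mat L"
    unfolding y_def by (rule A_mat_congruence[OF h])
  define B where "B = four_block_mat (A_mat k y h) (0\<^sub>m (Suc k) 1)
      (0\<^sub>m 1 (Suc k)) (mat 1 1 (\<lambda>_. g))"
  have B: "B \<in> carrier_mat (Suc (Suc k)) (Suc (Suc k))"
    unfolding B_def using four_block_carrier_mat[OF A_mat_carrier, of "mat 1 1 (\<lambda>_. g)" 1 1 k y h]
    by simp
  have "pos_semidef (A_mat (Suc k) x h) \<longleftrightarrow> pos_semidef B"
    unfolding eq B_def[symmetric] by (rule pos_semidef_congruence_iff[OF B L detL])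
  also have "\<dots> \<longleftrightarrow> pos_semidef (A_mat k y h)"
    unfolding B_def using g
    by (subst pos_semidef_block_diag) (simp_all only: A_mat_carrier mat_carrier pos_semidef_1x1, simp)
  finally have psd: "pos_semidef (A_mat (Suc k) x h) \<longleftrightarrow> pos_semidef (A_mat k y h)" .
  have "det B = det (A_mat k y h) * g"
    unfolding B_def
    by (subst det_four_block_mat_lower_left_zero[of _ "Suc k" _ 1]) (auto simp: det_single)
  then have "det (A_mat (Suc k) x h) = (det L)\<^sup>2 * g * det (A_mat k y h)"
    unfolding eq B_def[symmetric] using B L
    by (simp add: det_mult[of _ "Suc (Suc k)"] det_transpose power2_eq_square)
  moreover have "(det L)\<^sup>2 * g > 0" using detL g by simp
  ultimately have "det (A_mat (Suc k) x h) \<ge> 0 \<longleftrightarrow> det (A_mat k y h) \<ge> 0"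
    by (metis zero_le_mult_iff less_le_not_le)
  with psd Suc.IH[of y] f show ?case by simp
qed

section \<open>Closed forms of the two recursions\<close>

text \<open>The value 1 is a fixed point of every affine step of \<open>f_seq\<close>, so the
  distance to 1 is only multiplied by \<open>((c + 1) / c)\<^sup>2\<close>, which the product
  cancels.\<close>

lemma one_minus_f_final:
  assumes h: "h > 0"
  shows "(1 - f_final x h k) * (\<Prod>j=1..k. (real j * h / (real j * h + 1))\<^sup>2) = 1 - x"
proof (induction k arbitrary: x)
  case 0
  show ?case by (simp add: f_final_def)
next
  case (Suc k)
  define c where "c = real (Suc k) * h"
  have c: "c > 0" using h by (simp add: c_def)
  define y where "y = f_seq x h (Suc k) 1"
  have y: "y = x * ((c + 1) / c)\<^sup>2 - (2 * c + 1) / c\<^sup>2"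
    by (simp add: y_def c_def mult.assoc)
  have "f_final x h (Suc k) = f_final y h k"
    by (simp only: f_final_def y_def f_seq_Suc)
  then have "(1 - f_final x h (Suc k)) * (\<Prod>j=1..Suc k. (real j * h / (real j * h + 1))\<^sup>2)
      = (1 - y) * (c / (c + 1))\<^sup>2"
    using Suc.IH[of y] by (simp add: c_def mult.assoc[symmetric])
  also have "\<dots> = 1 - x"
    using c by (simp add: y field_simps) (simp add: power2_eq_square power4_eq_xxxx algebra_simps)
  finally show ?case .
qed

text \<open>The steps of \<open>b_seq\<close> also fix 1, and scale the distance to it by the
  factors of the product. The dummy value 0 at index 0 agrees with the empty product.\<close>

lemma b_seq_closed_form:
  assumes h: "h > 0"
  shows "b_seq k h = 1 - (\<Prod>j=1..k. (real j * h / (real j * h + 1))\<^sup>2)"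
  using h
proof (induction k h rule: b_seq.induct)
  case (1 h)
  show ?case by simp
next
  case (2 h)
  have "h + 1 \<noteq> 0" using 2 by simp
  then show ?case by (simp add: divide_simps) (simp add: power2_eq_square algebra_simps)
next
  case (3 n h)
  define c where "c = real (n + 2) * h"
  have c: "c > 0" using 3 by (simp add: c_def)
  define P where "P = (\<Prod>j=1..Suc n. (real j * h / (real j * h + 1))\<^sup>2)"
  have "b_seq (Suc (Suc n)) h = (1 - P + (2 * c + 1) / c\<^sup>2) * (c / (c + 1))\<^sup>2"
    using 3 by (simp add: P_def c_def Let_def mult.assoc)
  also have "\<dots> = 1 - P * (c / (c + 1))\<^sup>2"
  proof -
    have "(2 * c + 1) / c\<^sup>2 * (c / (c + 1))\<^sup>2 = 1 - (c / (c + 1))\<^sup>2"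
      using c by (simp add: power_divide divide_simps) (simp add: power2_eq_square algebra_simps)
    then show ?thesis by (simp add: algebra_simps)
  qed
  also have "P * (c / (c + 1))\<^sup>2 = (\<Prod>j=1..Suc (Suc n). (real j * h / (real j * h + 1))\<^sup>2)"
    by (simp add: P_def c_def)
  finally show ?case .
qed

text \<open>Both closed forms contain the same positive product \<open>P\<close>, and subtracting
  them gives \<open>x - b_seq k h = f_final x h k * P\<close>.\<close>

lemma f_final_nonneg_iff:
  assumes h: "h > 0"
  shows "f_final x h k \<ge> 0 \<longleftrightarrow> x \<ge> b_seq k h"
proof -
  define P where "P = (\<Prod>j=1..k. (real j * h / (real j * h + 1))\<^sup>2)"
  have "real j * h / (real j * h + 1) > 0" if "j \<in> {1..k}" for j
    using that h by (intro divide_pos_pos add_pos_pos mult_pos_pos) auto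
  then have "P > 0"
    unfolding P_def by (intro prod_pos ballI zero_less_power)
  moreover have "x - b_seq k h = f_final x h k * P"
    using one_minus_f_final[OF h, of x k] b_seq_closed_form[OF h, of k]
    unfolding P_def[symmetric] by (simp add: algebra_simps)
  ultimately show ?thesis
    by (smt (verit) zero_le_mult_iff)
qed

theorem theorem3p4:
  fixes x h :: real and k :: nat
  assumes "x > 0" and "h \<ge> 1" and "k \<ge> 1"
  shows "(pos_semidef (A_mat k x h) \<longleftrightarrow> det (A_mat k x h) \<ge> 0) \<and>
         (det (A_mat k x h) \<ge> 0 \<longleftrightarrow> f_final x h k \<ge> 0) \<and>
         (f_final x h k \<ge> 0 \<longleftrightarrow> x \<ge> b_seq k h)"
  using A_mat_psd_det_iff[of h k x] f_final_nonneg_iff[of h x k] assms by auto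

end
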